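(* If $d\ge 3$ is odd, then there are pseudo-real rational maps of degree $d$ admitting an antiholomorphic automorphism of order $4$.
   Context: An antiholomorphic automorphism of a complex rational map $\phi$ is a map $Q=T\circ J$, with $T\in\mathrm{PSL}_2(\mathbb{C})$ and $J(z)=\overline z$, such that $Q\circ\phi\circ Q^{-1}=\phi$. A reflection is an antiholomorphic involution of $\widehat{\mathbb{C}}$ with fixed points. A rational map is pseudo-real if it admits antiholomorphic automorphisms but none of them is a reflection. *)

theory Defs
  imports "HOL-Computational_Algebra.Polynomial" Complex_Main
begin

text \<open>
  The Riemann sphere as a set: \<open>None\<close> is the point at infinity. This is the point set of the
  library's one-point (Alexandroff) compactification.
\<close>
type_synonym riemann_sphere = "complex option"

text \<open>
  The map induced by \<open>p / q\<close> for coprime \<open>p\<close> and \<open>q\<close>. The value at infinity is the ratio of the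
  coefficients of degree \<open>max (degree p) (degree q)\<close>, at least one of which is nonzero.
\<close>
definition quotient_map :: "complex poly \<Rightarrow> complex poly \<Rightarrow> riemann_sphere \<Rightarrow> riemann_sphere" where
  "quotient_map p q w =
     (case w of
        Some z \<Rightarrow> (if poly q z = 0 then None else Some (poly p z / poly q z))
      | None \<Rightarrow>
          (let n = max (degree p) (degree q)
           in if coeff q n = 0 then None else Some (coeff p n / coeff q n)))"

text \<open>The only case with \<open>q = 0\<close> is the constant map with value infinity, which has degree 0.\<close>
definition rational_map_of_degree :: "nat \<Rightarrow> (riemann_sphere \<Rightarrow> riemann_sphere) \<Rightarrow> bool" where
  "rational_map_of_degree d \<phi> \<longleftrightarrow>
     (\<exists>p q. coprime p q \<and> max (degree p) (degree q) = d \<and> \<phi> = quotient_map p q)"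

definition mobius :: "complex \<Rightarrow> complex \<Rightarrow> complex \<Rightarrow> complex \<Rightarrow> riemann_sphere \<Rightarrow> riemann_sphere" where
  "mobius a b c d w =
     (case w of
        Some z \<Rightarrow> (if c * z + d = 0 then None else Some ((a * z + b) / (c * z + d)))
      | None \<Rightarrow> (if c = 0 then None else Some (a / c)))"

text \<open>Elements of \<open>PSL(2, \<complex>)\<close> are identified with the transformations of the sphere they induce.\<close>
definition PSL2C :: "(riemann_sphere \<Rightarrow> riemann_sphere) set" where
  "PSL2C = {T. \<exists>a b c d. a * d - b * c = 1 \<and> T = mobius a b c d}"

definition conj_map :: "riemann_sphere \<Rightarrow> riemann_sphere" where
  "conj_map = map_option cnj"

definition antiholomorphic_mobius :: "(riemann_sphere \<Rightarrow> riemann_sphere) \<Rightarrow> bool" where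
  "antiholomorphic_mobius Q \<longleftrightarrow> (\<exists>T\<in>PSL2C. Q = T \<circ> conj_map)"

definition antiholomorphic_automorphism ::
    "(riemann_sphere \<Rightarrow> riemann_sphere) \<Rightarrow> (riemann_sphere \<Rightarrow> riemann_sphere) \<Rightarrow> bool" where
  "antiholomorphic_automorphism \<phi> Q \<longleftrightarrow> antiholomorphic_mobius Q \<and> Q \<circ> \<phi> \<circ> inv Q = \<phi>"

text \<open>
  The antiholomorphic bijections of the sphere are exactly the maps \<open>T \<circ> conj_map\<close> with
  \<open>T \<in> PSL2C\<close>; none of them is the identity, so \<open>Q \<circ> Q = id\<close> does say that the order is 2.
\<close>
definition is_reflection :: "(riemann_sphere \<Rightarrow> riemann_sphere) \<Rightarrow> bool" where
  "is_reflection Q \<longleftrightarrow> antiholomorphic_mobius Q \<and> Q \<circ> Q = id \<and> (\<exists>w. Q w = w)"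

definition pseudo_real :: "(riemann_sphere \<Rightarrow> riemann_sphere) \<Rightarrow> bool" where
  "pseudo_real \<phi> \<longleftrightarrow>
     (\<exists>Q. antiholomorphic_automorphism \<phi> Q) \<and>
     (\<forall>Q. antiholomorphic_automorphism \<phi> Q \<longrightarrow> \<not> is_reflection Q)"

definition has_order :: "('a \<Rightarrow> 'a) \<Rightarrow> nat \<Rightarrow> bool" where
  "has_order f n \<longleftrightarrow> n > 0 \<and> f ^^ n = id \<and> (\<forall>k. 0 < k \<and> k < n \<longrightarrow> f ^^ k \<noteq> id)"

end

theory Submission
  imports Defs "HOL-Computational_Algebra.Polynomial_Factorial" "HOL-Computational_Algebra.Field_as_Ring"
begin

text \<open>
  Write \<open>d = m + 2\<close> with \<open>m\<close> odd, and put \<open>\<psi> z = \<i> z\<^sup>m (z\<^sup>2 - 1) / (z\<^sup>2 + 1)\<close>, a map of degree \<open>d\<close>.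
  The map \<open>Q z = \<i> / cnj z\<close> has \<open>Q (Q z) = - z\<close>, hence order 4. Since the factor
  \<open>B z = (z\<^sup>2 - 1) / (z\<^sup>2 + 1)\<close> satisfies \<open>B (\<i> / cnj z) = - 1 / cnj (B z)\<close>, only the power of \<open>\<i>\<close>
  produced by \<open>z\<^sup>m\<close> matters: \<open>Q\<close> commutes with \<open>\<psi>\<close> when \<open>m \<equiv> 3\<close> modulo 4 and with \<open>1 / \<psi>\<close> when
  \<open>m \<equiv> 1\<close> modulo 4 (lemma \<open>commuting_Q4\<close>). So \<open>\<phi>\<close> is \<open>\<psi>\<close> or \<open>1 / \<psi>\<close>, according to \<open>d\<close> modulo 4.

  The work is to show that no antiholomorphic involution
  \<open>z \<mapsto> (a cnj z + b) / (c cnj z + d)\<close> commutes with \<open>\<phi>\<close>. Such a commutation equates the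
  composite of \<open>\<psi>\<close> with a Moebius map \<open>M\<close> and another Moebius image of \<open>\<psi>\<close>. Both sides are
  quotients of pairs of degree \<open>d\<close>, so numerators and denominators agree up to one common constant
  (\<open>proportional_pairs\<close>). The key consequence is that \<open>M\<close> preserves \<open>{0, \<infinity>}\<close>
  (\<open>diagonal_or_antidiagonal\<close>). For \<open>m \<ge> 3\<close> this is because 0 and infinity are the only points at
  which \<open>\<psi>\<close> has local degree at least 3 (\<open>no_triple_root\<close>). For \<open>m = 1\<close> they are not critical;
  there one compares the divergences of the homogeneous lifts of \<open>\<phi>\<close> and of its complex conjugate:
  \<open>M\<close> relates these two quadratic forms up to a constant, and both are multiples of \<open>x y\<close>
  (\<open>matching_cubic\<close>).

  There remain two kinds of involution. Those of the form \<open>z \<mapsto> u cnj z\<close> do not commute because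
  the zeros \<open>\<plusminus>1\<close> of \<open>\<psi>\<close> force \<open>u\<^sup>2 = 1\<close>, after which the coefficient \<open>\<i>\<close> and its conjugate give
  opposite signs (\<open>not_diagonal\<close>). For the form \<open>z \<mapsto> u / cnj z\<close> the zeros and poles of \<open>\<psi>\<close> force
  \<open>u\<^sup>2 = - 1\<close>, whereas an involution of this form has \<open>u\<close> real.
\<close>

section \<open>Homogeneous coordinates on the sphere\<close>

definition point :: "complex \<Rightarrow> complex \<Rightarrow> riemann_sphere" where
  "point x y = (if y = 0 then None else Some (x / y))"

lemma sphere_cases:
  obtains x y where "w = point x y" "x \<noteq> 0 \<or> y \<noteq> 0"
proof (cases w)
  case None
  then show ?thesis using that[of 1 0] by (simp add: point_def)
next
  case (Some z)
  then show ?thesis using that[of z 1] by (simp add: point_def)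
qed

lemma point_eq_iff:
  assumes "x \<noteq> 0 \<or> y \<noteq> 0" "x' \<noteq> 0 \<or> y' \<noteq> 0"
  shows "point x y = point x' y' \<longleftrightarrow> x * y' = x' * y"
  using assms by (cases "y = 0"; cases "y' = 0") (simp_all add: point_def frac_eq_eq)

lemma mobius_point:
  assumes "x \<noteq> 0 \<or> y \<noteq> 0"
  shows "mobius a b c d (point x y) = point (a * x + b * y) (c * x + d * y)"
proof (cases "y = 0")
  case True
  then show ?thesis using assms by (auto simp: point_def mobius_def)
next
  case False
  have frac: "u * (x / y) + v = (u * x + v * y) / y" for u v
    using False by (simp add: add_divide_distrib)
  have cancel: "(p / y) / (q / y) = p / q" for p q
    using False by simp
  have "c * (x / y) + d = 0 \<longleftrightarrow> c * x + d * y = 0"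
    by (simp only: frac divide_eq_0_iff False simp_thms)
  moreover have "(a * (x / y) + b) / (c * (x / y) + d) = (a * x + b * y) / (c * x + d * y)"
    by (simp only: frac cancel)
  ultimately show ?thesis using False
    by (simp only: point_def mobius_def option.case if_False)
qed

lemma conj_map_point: "conj_map (point x y) = point (cnj x) (cnj y)"
  by (simp add: point_def conj_map_def)

lemma linear_nonzero:
  fixes a b c d x y :: "'a::field"
  assumes "a * d - b * c \<noteq> 0" "x \<noteq> 0 \<or> y \<noteq> 0"
  shows "a * x + b * y \<noteq> 0 \<or> c * x + d * y \<noteq> 0"
proof (rule ccontr)
  assume "\<not> ?thesis"
  then have "a * x + b * y = 0" "c * x + d * y = 0" by auto
  then have "(a * d - b * c) * x = 0" "(a * d - b * c) * y = 0" by algebra+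
  then show False using assms by auto
qed

text \<open>
  In homogeneous coordinates the separate value at infinity disappears: \<open>F\<close> and \<open>G\<close> stand for the
  degree \<open>d\<close> homogenizations of \<open>p\<close> and \<open>q\<close>.
\<close>
lemma quotient_map_point:
  fixes F G :: "complex \<Rightarrow> complex \<Rightarrow> complex"
  assumes d: "max (degree p) (degree q) = d"
    and F: "\<And>x y. y \<noteq> 0 \<Longrightarrow> F x y = y ^ d * poly p (x / y)" "\<And>x. F x 0 = coeff p d * x ^ d"
    and G: "\<And>x y. y \<noteq> 0 \<Longrightarrow> G x y = y ^ d * poly q (x / y)" "\<And>x. G x 0 = coeff q d * x ^ d"
    and nz: "x \<noteq> 0 \<or> y \<noteq> 0"
  shows "quotient_map p q (point x y) = point (F x y) (G x y)"
proof (cases "y = 0")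
  case True
  then show ?thesis using nz d by (auto simp: quotient_map_def point_def F G Let_def)
next
  case False
  then show ?thesis by (auto simp: quotient_map_def point_def F G)
qed

section \<open>The forms defining the maps\<close>

text \<open>
  The forms are defined over any commutative ring, so that they can be evaluated both at complex
  numbers and at the linear polynomials that describe a Moebius map.
\<close>
definition num_form :: "nat \<Rightarrow> 'a \<Rightarrow> 'a \<Rightarrow> 'a::comm_ring_1" where
  "num_form m x y = x ^ m * (x\<^sup>2 - y\<^sup>2)"

definition den_form :: "nat \<Rightarrow> 'a \<Rightarrow> 'a \<Rightarrow> 'a::comm_ring_1" where
  "den_form m x y = y ^ m * (x\<^sup>2 + y\<^sup>2)"

lemma poly_num_form [simp]: "poly (num_form m X Y) z = num_form m (poly X z) (poly Y z)"
  by (simp add: num_form_def)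

lemma poly_den_form [simp]: "poly (den_form m X Y) z = den_form m (poly X z) (poly Y z)"
  by (simp add: den_form_def)

lemma forms_nonzero:
  fixes x y :: "'a::field_char_0"
  assumes "m > 0" "x \<noteq> 0 \<or> y \<noteq> 0"
  shows "num_form m x y \<noteq> 0 \<or> den_form m x y \<noteq> 0"
proof (rule ccontr)
  assume "\<not> ?thesis"
  then have h: "x = 0 \<or> x\<^sup>2 = y\<^sup>2" "y = 0 \<or> x\<^sup>2 + y\<^sup>2 = 0"
    using assms(1) by (auto simp: num_form_def den_form_def)
  have "x\<^sup>2 = y\<^sup>2 \<Longrightarrow> x\<^sup>2 + y\<^sup>2 = 2 * y\<^sup>2" by simp
  with h assms(2) show False by auto
qed

abbreviation zvar :: "complex poly" where "zvar \<equiv> [:0, 1:]"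

lemma num_form_zvar: "num_form m zvar 1 = monom 1 (m + 2) - monom 1 m"
  by (rule poly_ext) (simp add: num_form_def poly_monom algebra_simps power_add power2_eq_square)

lemma den_form_zvar: "den_form m zvar 1 = [:1, 0, 1:]"
  by (rule poly_ext) (simp add: den_form_def power2_eq_square)

lemma degree_num_form: "degree (num_form m zvar 1) = m + 2"
proof -
  have "degree (monom (1::complex) (m + 2) - monom 1 m) = m + 2"
    by (intro antisym degree_le le_degree) (auto)
  then show ?thesis by (simp only: num_form_zvar)
qed

lemma degree_den_form: "degree (den_form m zvar 1) = 2"
  by (simp add: den_form_zvar)

lemma coprime_forms:
  assumes "m > 0"
  shows "coprime (num_form m zvar 1) (den_form m zvar 1)"
proof -
  have "coprime zvar [:1, 0, 1:]"
  proof (rule coprimeI)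
    fix c :: "complex poly" assume c: "c dvd zvar" "c dvd [:1, 0, 1:]"
    have "c dvd [:1, 0, 1:] - zvar * zvar" using c by (intro dvd_diff dvd_mult2) auto
    then show "is_unit c" by (simp add: one_pCons)
  qed
  moreover have "coprime (zvar\<^sup>2 - 1) [:1, 0, 1:]"
  proof (rule coprimeI)
    fix c :: "complex poly" assume c: "c dvd zvar\<^sup>2 - 1" "c dvd [:1, 0, 1:]"
    have "c dvd [:1, 0, 1:] - (zvar\<^sup>2 - 1)" using c by (rule dvd_diff[rotated])
    also have "[:1, 0, 1:] - (zvar\<^sup>2 - 1) = [:2:]" by (simp add: power2_eq_square one_pCons)
    finally show "is_unit c" by (rule dvd_trans) (simp add: is_unit_pCons_iff)
  qed
  ultimately show ?thesis
    unfolding den_form_zvar by (simp add: num_form_def coprime_power_left_iff)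
qed

section \<open>Uniqueness of a coprime representation\<close>

text \<open>
  Equal fractions with equal degrees differ by a constant factor: an invertible combination of the
  coprime pair \<open>f, g\<close> is again coprime and its larger degree is still \<open>d\<close>, so the common factor
  that relates it to \<open>P, R\<close> has no room for a positive degree.
\<close>
lemma proportional_pairs:
  fixes P R f g :: "'a::field_gcd poly"
  assumes cop: "coprime f g" and det: "A * B' - A' * B \<noteq> 0" and d: "max (degree f) (degree g) = d" "d > 0"
    and deg: "degree P \<le> d" "degree R \<le> d"
    and eq: "P * (smult A' f + smult B' g) = R * (smult A f + smult B g)"
  obtains l where "P = smult l (smult A f + smult B g)" "R = smult l (smult A' f + smult B' g)"
proof -
  define u where "u = smult A f + smult B g"
  define v where "v = smult A' f + smult B' g"
  have f: "smult B' u - smult B v = smult (A * B' - A' * B) f"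
    by (simp add: u_def v_def smult_add_right smult_diff_left algebra_simps)
  have g: "smult A v - smult A' u = smult (A * B' - A' * B) g"
    by (simp add: u_def v_def smult_add_right smult_diff_left algebra_simps)
  have cuv: "coprime u v"
  proof (rule coprimeI)
    fix c assume c: "c dvd u" "c dvd v"
    have "c dvd smult (A * B' - A' * B) f" "c dvd smult (A * B' - A' * B) g"
      unfolding f[symmetric] g[symmetric] using c by (auto intro!: dvd_diff dvd_smult)
    then have "c dvd f" "c dvd g" using det by (auto simp: dvd_smult_iff)
    then show "is_unit c" using cop by (rule coprime_common_divisor[rotated])
  qed
  have degf: "degree f \<le> max (degree u) (degree v)"
  proof -
    have "degree f = degree (smult B' u - smult B v)" unfolding f using det by simp
    also have "\<dots> \<le> max (degree (smult B' u)) (degree (smult B v))" by (rule degree_diff_le_max)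
    also have "\<dots> \<le> max (degree u) (degree v)" by (intro max.mono degree_smult_le)
    finally show ?thesis .
  qed
  have degg: "degree g \<le> max (degree u) (degree v)"
  proof -
    have "degree g = degree (smult A v - smult A' u)" unfolding g using det by simp
    also have "\<dots> \<le> max (degree (smult A v)) (degree (smult A' u))" by (rule degree_diff_le_max)
    also have "\<dots> \<le> max (degree v) (degree u)" by (intro max.mono degree_smult_le)
    finally show ?thesis by (simp add: max.commute)
  qed
  have du: "d \<le> max (degree u) (degree v)" using degf degg d by simp
  have eq': "P * v = R * u" using eq by (simp add: u_def v_def)
  then have "u dvd P * v" by simp
  then have "u dvd P" using cuv by (simp add: coprime_dvd_mult_left_iff)
  then obtain k where k: "P = u * k" by auto
  have u0: "u \<noteq> 0"
  proof
    assume "u = 0"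
    moreover from this have "is_unit v" using cuv by simp
    ultimately show False using du \<open>d > 0\<close> by (auto simp: is_unit_poly_iff)
  qed
  have Rk: "R = v * k" using eq' u0 k by (simp add: mult_ac)
  have v0: "v \<noteq> 0"
  proof
    assume "v = 0"
    moreover from this have "is_unit u" using cuv by simp
    ultimately show False using du \<open>d > 0\<close> by (auto simp: is_unit_poly_iff)
  qed
  have "degree k = 0"
  proof (cases "k = 0")
    case False
    have "degree u + degree k \<le> d" "degree v + degree k \<le> d"
      using deg False u0 v0 unfolding k Rk by (simp_all add: degree_mult_eq)
    then show ?thesis using du by linarith
  qed simp
  then obtain l where "k = [:l:]" by (rule degree_eq_zeroE)
  then have "P = smult l u" "R = smult l v" using k Rk by simp_all
  then show thesis using that unfolding u_def v_def by blast
qed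

section \<open>Triple points\<close>

lemma power_dvd_pderiv:
  fixes p q :: "'a::idom poly"
  assumes "p ^ Suc n dvd q"
  shows "p ^ n dvd pderiv q"
proof -
  obtain k where "q = p ^ Suc n * k" using assms by auto
  then have "pderiv q = p ^ n * (p * pderiv k + smult (of_nat (Suc n)) (pderiv p) * k)"
    by (simp only: pderiv_mult pderiv_power_Suc) (simp add: algebra_simps del: of_nat_Suc)
  then show ?thesis by simp
qed

text \<open>
  The fibre of the map \<open>\<psi>\<close> over a value other than 0 and infinity contains no point of local
  degree 3. With \<open>m = n + 2\<close>, vanishing of the first two derivatives at a nonzero \<open>z0\<close> forces
  \<open>z0\<^sup>2 = n / (n + 4)\<close>, which is real, and then vanishing of the polynomial itself forces
  \<open>z0\<^sup>4 = - 1\<close>.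
\<close>
lemma no_triple_root:
  fixes A B z0 :: complex
  assumes m: "m \<ge> 3" and dvd: "[:-z0, 1:] ^ 3 dvd smult A (num_form m zvar 1) + smult B (den_form m zvar 1)"
  shows "A = 0 \<or> B = 0"
proof (rule ccontr)
  assume "\<not> ?thesis"
  then have A: "A \<noteq> 0" and B: "B \<noteq> 0" by auto
  obtain n where n: "m = n + 2" using that[of "m - 2"] m by simp
  let ?h = "smult A (num_form m zvar 1) + smult B (den_form m zvar 1)"
  have h: "?h = smult A (monom 1 (n + 4)) - smult A (monom 1 (n + 2)) + smult B [:1, 0, 1:]"
    by (simp add: num_form_zvar den_form_zvar n smult_diff_right add.commute numeral_eq_Suc)
  have Suc: "Suc 2 = 3" "Suc 1 = 2" "Suc 0 = 1" by simp_all
  have dvd1: "[:-z0, 1:] ^ 2 dvd pderiv ?h"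
    by (rule power_dvd_pderiv) (unfold Suc, rule dvd)
  have dvd2: "[:-z0, 1:] ^ 1 dvd pderiv (pderiv ?h)"
    by (rule power_dvd_pderiv) (unfold Suc, rule dvd1)
  have root: "poly q z0 = 0" if "[:-z0, 1:] ^ Suc k dvd q" for q k
    unfolding poly_eq_0_iff_dvd using that by (rule dvd_trans[rotated]) (rule dvd_power, simp)
  have "poly ?h z0 = 0" by (rule root[of 2]) (unfold Suc, rule dvd)
  then have h0: "A * z0 ^ (n + 4) - A * z0 ^ (n + 2) + B * (1 + z0\<^sup>2) = 0"
    unfolding h by (simp add: poly_monom power2_eq_square algebra_simps)
  have "poly (pderiv ?h) z0 = 0" by (rule root[of 1]) (unfold Suc, rule dvd1)
  then have h1: "A * (of_nat n + 4) * z0 ^ (n + 3) - A * (of_nat n + 2) * z0 ^ (n + 1) + 2 * B * z0 = 0"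
    unfolding h by (simp add: poly_monom pderiv_monom pderiv_diff pderiv_add pderiv_smult pderiv_pCons algebra_simps)
  have "poly (pderiv (pderiv ?h)) z0 = 0"
    by (rule root[of 0]) (unfold Suc, rule dvd2)
  then have h2: "A * (of_nat n + 4) * (of_nat n + 3) * z0 ^ (n + 2) - A * (of_nat n + 2) * (of_nat n + 1) * z0 ^ n + 2 * B = 0"
    unfolding h by (simp add: poly_monom pderiv_monom pderiv_diff pderiv_add pderiv_smult pderiv_pCons algebra_simps)
  have z0: "z0 \<noteq> 0" using h0 B by (auto simp: power_0_left)
  (* Naming the power and the coefficient turns the three conditions into polynomial identities of
     fixed degree. *)
  define w N :: complex where "w = z0 ^ n" and "N = of_nat n"
  have w: "w \<noteq> 0" using z0 by (simp add: w_def)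
  have N2: "N + 2 \<noteq> 0"
    using of_nat_neq_0[of "n + 1", where ?'a = complex] by (simp add: N_def add.commute)
  note h0' = h0[unfolded power_add, folded w_def N_def]
  note h1' = h1[unfolded power_add, folded w_def N_def]
  note h2' = h2[unfolded power_add, folded w_def N_def]
  have "A * (w * z0) * (N + 2) * ((N + 4) * z0\<^sup>2 - N) = 0"
    using h1' h2' by algebra
  then have t: "(N + 4) * z0\<^sup>2 = N"
    using A w z0 N2 by simp
  have "z0 * (- 2 * A * w + 2 * B) = 0"
    using h1' t by algebra
  then have BA: "B = A * w" using z0 by simp
  have "A * w * ((z0\<^sup>2)\<^sup>2 + 1) = 0"
    using h0' BA by algebra
  then have minus1: "(z0\<^sup>2)\<^sup>2 = -1" using A w by (simp add: eq_neg_iff_add_eq_0)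
  have real: "z0\<^sup>2 = complex_of_real (real n / (real n + 4))"
  proof -
    have "N + 4 \<noteq> 0"
      using of_nat_neq_0[of "n + 3", where ?'a = complex] by (simp add: N_def add.commute)
    then have "z0\<^sup>2 = N / (N + 4)" using t by (simp add: eq_divide_eq mult.commute)
    then show ?thesis by (simp add: N_def)
  qed
  have "complex_of_real ((real n / (real n + 4))\<^sup>2) = complex_of_real (-1)"
    using minus1 unfolding real of_real_power by simp
  then have "(real n / (real n + 4))\<^sup>2 = -1" by (simp only: of_real_eq_iff)
  then show False by (smt (verit) zero_le_power2)
qed

text \<open>
  This is how the absence of triple roots is used: \<open>X\<close> is a coordinate of a Moebius map, and
  \<open>X ^ m * K\<close> one of the two forms composed with it. A constant \<open>X\<close> means that the triple point
  lies at infinity, where it shows up as a drop of the degree.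
\<close>
lemma pencil_divisible_by_power:
  fixes A B l :: complex and X K :: "complex poly"
  assumes m: "m \<ge> 3" and l: "l \<noteq> 0" and X: "X \<noteq> 0" "degree X \<le> 1" and K: "degree K \<le> 2"
    and eq: "X ^ m * K = smult l (smult A (num_form m zvar 1) + smult B (den_form m zvar 1))"
  shows "A = 0 \<or> B = 0"
proof (cases "degree X = 0")
  case True
  have "coeff (X ^ m * K) (m + 2) = 0"
  proof (rule coeff_eq_0)
    have "degree (X ^ m * K) \<le> degree X * m + degree K"
      by (rule order_trans[OF degree_mult_le]) (simp add: degree_power_le)
    then show "degree (X ^ m * K) < m + 2" using True K m by simp
  qed
  moreover have "coeff (smult l (smult A (num_form m zvar 1) + smult B (den_form m zvar 1))) (m + 2) = l * A"
    using m by (simp add: num_form_zvar den_form_zvar coeff_pCons split: nat.splits)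
  ultimately show ?thesis using l eq by simp
next
  case False
  then have "degree X = 1" using X by simp
  then obtain b a where ab: "X = [:b, a:]" "a \<noteq> 0" by (metis degree1_coeffs)
  then have "X = smult a [:- (- b / a), 1:]" by simp
  then have "[:- (- b / a), 1:] ^ 3 dvd X ^ 3" by (metis dvd_power_same dvd_smult dvd_refl)
  also have "X ^ 3 dvd X ^ m * K" using m by (simp add: le_imp_power_dvd)
  finally have "[:- (- b / a), 1:] ^ 3 dvd smult A (num_form m zvar 1) + smult B (den_form m zvar 1)"
    using l unfolding eq by (simp add: dvd_smult_iff)
  then show ?thesis by (rule no_triple_root[OF m])
qed

section \<open>The cubic case\<close>

text \<open>
  For a homogeneous self-map \<open>(F, G)\<close> of the plane, the divergence \<open>F\<^sub>x + G\<^sub>y\<close> does not change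
  when the same linear change of coordinates is made in source and target. For the lift of \<open>1 / \<psi>\<close> with \<open>m = 1\<close> it is
  \<open>2 (1 - \<i>) x y\<close>, and for the conjugate lift it is \<open>2 (1 + \<i>) x y\<close>. Hence the product of the two
  coordinates \<open>a z + b\<close> and \<open>c z + d\<close> is a constant times \<open>z\<close>, so that its extreme
  coefficients \<open>a c\<close> and \<open>b d\<close> vanish.
\<close>
lemma matching_cubic:
  fixes a b c d l :: complex
  assumes det: "a * d - b * c \<noteq> 0"
    and P: "num_form 1 [:b, a:] [:d, c:] = smult l (smult (- \<i> * d) (num_form 1 zvar 1) + smult c (den_form 1 zvar 1))"
    and R: "den_form 1 [:b, a:] [:d, c:] = smult l (smult b (num_form 1 zvar 1) + smult (\<i> * a) (den_form 1 zvar 1))"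
  shows "a * c = 0 \<and> b * d = 0"
proof -
  have i1: "1 - \<i> \<noteq> 0" by (simp add: complex_eq_iff)
  have P': "b ^ 3 - b * d\<^sup>2 = l * c" "3 * a * b\<^sup>2 - a * d\<^sup>2 - 2 * b * c * d = l * \<i> * d"
     "3 * a\<^sup>2 * b - 2 * a * c * d - b * c\<^sup>2 = l * c" "a ^ 3 - a * c\<^sup>2 = - l * \<i> * d"
    using P by (simp_all add: num_form_def den_form_def power2_eq_square power3_eq_cube algebra_simps one_pCons)
  have R': "b\<^sup>2 * d + d ^ 3 = l * \<i> * a" "b\<^sup>2 * c + 2 * a * b * d + 3 * c * d\<^sup>2 = - l * b"
     "2 * a * b * c + a\<^sup>2 * d + 3 * c\<^sup>2 * d = l * \<i> * a" "a\<^sup>2 * c + c ^ 3 = l * b"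
    using R by (simp_all add: num_form_def den_form_def power2_eq_square power3_eq_cube algebra_simps one_pCons)
  (* Both sides are the determinant times the coefficient of z^2 in the divergence of the composed
     lift; the right-hand side computes it from the coefficients of the composed forms. *)
  have "2 * (1 - \<i>) * (a * c) * (a * d - b * c) =
     3 * (d * (a\<^sup>2 * c + c ^ 3) - \<i> * b * (a ^ 3 - a * c\<^sup>2)) +
     (\<i> * a * (3 * a\<^sup>2 * b - 2 * a * c * d - b * c\<^sup>2) - c * (2 * a * b * c + a\<^sup>2 * d + 3 * c\<^sup>2 * d))"
    by algebra
  also have "\<dots> = 0" unfolding P' R' by (simp add: algebra_simps)
  finally have ac: "a * c = 0" using det i1 by simp
  (* The same comparison for the constant coefficient of the divergence. *)
  have "2 * (1 - \<i>) * (b * d) * (a * d - b * c) =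
     (d * (b\<^sup>2 * c + 2 * a * b * d + 3 * c * d\<^sup>2) - \<i> * b * (3 * a * b\<^sup>2 - a * d\<^sup>2 - 2 * b * c * d)) +
     3 * (\<i> * a * (b ^ 3 - b * d\<^sup>2) - c * (b\<^sup>2 * d + d ^ 3))"
    by algebra
  also have "\<dots> = 0" unfolding P' R' by (simp add: algebra_simps)
  finally have "b * d = 0" using det i1 by simp
  with ac show ?thesis by simp
qed

section \<open>Commuting with an antiholomorphic involution\<close>

lemma degree_forms_linear:
  fixes X Y :: "complex poly"
  assumes "degree X \<le> 1" "degree Y \<le> 1"
  shows "degree (num_form m X Y) \<le> m + 2" "degree (den_form m X Y) \<le> m + 2"
proof -
  have pow: "degree (X ^ k) \<le> k" "degree (Y ^ k) \<le> k" for k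
    using order_trans[OF degree_power_le[of X k] mult_le_mono1[OF assms(1)]]
      order_trans[OF degree_power_le[of Y k] mult_le_mono1[OF assms(2)]] by simp_all
  show "degree (num_form m X Y) \<le> m + 2" "degree (den_form m X Y) \<le> m + 2"
    unfolding num_form_def den_form_def
    by (rule order_trans[OF degree_mult_le] add_mono degree_diff_le degree_add_le pow)+
qed

text \<open>
  Commutation of \<open>z \<mapsto> (a cnj z + b) / (c cnj z + d)\<close> with \<open>\<psi>\<close> or with \<open>1 / \<psi>\<close> leads to the same
  equation \<open>cross\<close>, with the two assignments of \<open>A, B, A', B'\<close> listed in \<open>coeffs\<close>. They differ by
  exchanging \<open>a\<close> with \<open>d\<close> and \<open>b\<close> with \<open>c\<close>. The case \<open>m = 1\<close> is covered for \<open>1 / \<psi>\<close> only.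
\<close>
lemma diagonal_or_antidiagonal:
  fixes a b c d A B A' B' :: complex
  assumes m: "odd m" and det: "a * d - b * c \<noteq> 0"
    and coeffs: "m \<ge> 3 \<and> A = - \<i> * a \<and> B = b \<and> A' = c \<and> B' = \<i> * d \<or>
                 A = - \<i> * d \<and> B = c \<and> A' = b \<and> B' = \<i> * a"
    and cross: "\<And>z. num_form m (a * z + b) (c * z + d) * (A' * num_form m z 1 + B' * den_form m z 1) =
                     den_form m (a * z + b) (c * z + d) * (A * num_form m z 1 + B * den_form m z 1)"
  shows "b = 0 \<and> c = 0 \<or> a = 0 \<and> d = 0"
proof -
  let ?X = "[:b, a:]" and ?Y = "[:d, c:]"
  have m0: "m > 0" using m by (rule odd_pos)
  have det': "A * B' - A' * B \<noteq> 0"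
    using coeffs det by (auto simp: algebra_simps)
  have "poly (num_form m ?X ?Y * (smult A' (num_form m zvar 1) + smult B' (den_form m zvar 1))) z =
        poly (den_form m ?X ?Y * (smult A (num_form m zvar 1) + smult B (den_form m zvar 1))) z" for z
    using cross[of z] by (simp add: algebra_simps)
  then have eq: "num_form m ?X ?Y * (smult A' (num_form m zvar 1) + smult B' (den_form m zvar 1)) =
        den_form m ?X ?Y * (smult A (num_form m zvar 1) + smult B (den_form m zvar 1))"
    by (rule poly_ext)
  have dXY: "degree ?X \<le> 1" "degree ?Y \<le> 1" by (auto intro: order_trans[OF degree_pCons_le])
  have dfg: "max (degree (num_form m zvar 1)) (degree (den_form m zvar 1)) = m + 2"
    by (simp add: degree_num_form degree_den_form)
  obtain l where l: "num_form m ?X ?Y = smult l (smult A (num_form m zvar 1) + smult B (den_form m zvar 1))"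
      "den_form m ?X ?Y = smult l (smult A' (num_form m zvar 1) + smult B' (den_form m zvar 1))"
    by (rule proportional_pairs[OF coprime_forms[OF m0] det' dfg _ degree_forms_linear[OF dXY] eq]) simp
  have nz: "?X \<noteq> 0" "?Y \<noteq> 0" using det by auto
  have l0: "l \<noteq> 0"
  proof
    assume "l = 0"
    then have "poly (num_form m ?X ?Y) z = 0" "poly (den_form m ?X ?Y) z = 0" for z using l by simp_all
    then have *: "num_form m (b + z * a) (d + z * c) = 0" "den_form m (b + z * a) (d + z * c) = 0" for z
      by simp_all
    have "b + z * a = 0 \<and> d + z * c = 0" for z using forms_nonzero[OF m0] * by blast
    from this[of 0] this[of 1] det show False by simp
  qed
  show ?thesis
  proof (cases "m \<ge> 3")
    case True
    have dK: "degree (?X\<^sup>2 - ?Y\<^sup>2) \<le> 2" "degree (?X\<^sup>2 + ?Y\<^sup>2) \<le> 2"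
      using degree_forms_linear[OF dXY, of 0] by (simp_all add: num_form_def den_form_def)
    have "A = 0 \<or> B = 0"
      using pencil_divisible_by_power[OF True l0 nz(1) dXY(1) dK(1)] l(1) by (simp add: num_form_def)
    moreover have "A' = 0 \<or> B' = 0"
      using pencil_divisible_by_power[OF True l0 nz(2) dXY(2) dK(2)] l(2) by (simp add: den_form_def)
    ultimately show ?thesis using coeffs det by auto
  next
    case False
    then have "m = 1" using m by presburger
    with coeffs have "A = - \<i> * d \<and> B = c \<and> A' = b \<and> B' = \<i> * a" by simp
    then have "a * c = 0 \<and> b * d = 0" using matching_cubic[OF det] l \<open>m = 1\<close> by simp
    then show ?thesis using det by auto
  qed
qed

text \<open>
  Here \<open>z = 1\<close>, a zero of \<open>\<psi>\<close>, yields \<open>a\<^sup>2 = d\<^sup>2\<close>; since \<open>m\<close> is odd, only the sign conflict between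
  \<open>\<i>\<close> and its conjugate is left, and the generic argument \<open>z = 2\<close> exhibits it.
\<close>
lemma not_diagonal:
  fixes a d :: complex
  assumes m: "odd m" and a: "a \<noteq> 0" and d: "d \<noteq> 0"
    and coeffs: "A = - \<i> * a \<and> B' = \<i> * d \<or> A = - \<i> * d \<and> B' = \<i> * a"
    and cross: "\<And>z. num_form m (a * z) d * (B' * den_form m z 1) = den_form m (a * z) d * (A * num_form m z 1)"
  shows False
proof -
  obtain j where j: "m = 2 * j + 1" using m by (elim oddE)
  have "B' \<noteq> 0" using coeffs a d by auto
  then have sq: "a\<^sup>2 = d\<^sup>2" using cross[of 1] a by (simp add: num_form_def den_form_def)
  have sqj: "a ^ m = a * (d\<^sup>2) ^ j" "d ^ m = d * (d\<^sup>2) ^ j"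
    by (simp_all add: j power_mult sq)
  have "a ^ m * 2 ^ m * (3 * d\<^sup>2) * (B' * 5) = d ^ m * (5 * d\<^sup>2) * (A * (2 ^ m * 3))"
    using cross[of 2] by (simp add: num_form_def den_form_def power_mult_distrib sq)
  then have "(d\<^sup>2) ^ j * 2 ^ m * d\<^sup>2 * 15 * (a * B' - d * A) = 0"
    unfolding sqj by (simp add: algebra_simps)
  then have eq: "a * B' = d * A" using d by simp
  from coeffs show False
  proof
    assume "A = - \<i> * a \<and> B' = \<i> * d"
    then have "2 * \<i> * (a * d) = 0" using eq by (simp add: algebra_simps)
    then show False using a d by simp
  next
    assume "A = - \<i> * d \<and> B' = \<i> * a"
    then have "\<i> * (a\<^sup>2 + d\<^sup>2) = 0" using eq by (simp add: algebra_simps power2_eq_square)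
    then show False using d sq by simp
  qed
qed

lemma cnj_forms [simp]:
  "cnj (num_form m x y) = num_form m (cnj x) (cnj y)" "cnj (den_form m x y) = den_form m (cnj x) (cnj y)"
  by (simp_all add: num_form_def den_form_def)

text \<open>
  The maps \<open>\<psi>\<close> and \<open>1 / \<psi>\<close>. The names refer to what they do with the pair 0, infinity when
  \<open>m > 0\<close>.
\<close>
definition phi_fixing :: "nat \<Rightarrow> riemann_sphere \<Rightarrow> riemann_sphere" where
  "phi_fixing m = quotient_map (smult \<i> (num_form m zvar 1)) (den_form m zvar 1)"

definition phi_swapping :: "nat \<Rightarrow> riemann_sphere \<Rightarrow> riemann_sphere" where
  "phi_swapping m = quotient_map (den_form m zvar 1) (smult \<i> (num_form m zvar 1))"

lemma homogeneous_forms: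
  "y \<noteq> 0 \<Longrightarrow> num_form m x y = y ^ (m + 2) * poly (num_form m zvar 1) (x / y)"
  "y \<noteq> 0 \<Longrightarrow> den_form m x y = y ^ (m + 2) * poly (den_form m zvar 1) (x / y)"
  "num_form m x 0 = coeff (num_form m zvar 1) (m + 2) * x ^ (m + 2)"
  "m > 0 \<Longrightarrow> den_form m x 0 = coeff (den_form m zvar 1) (m + 2) * x ^ (m + 2)"
proof -
  show "num_form m x y = y ^ (m + 2) * poly (num_form m zvar 1) (x / y)" if "y \<noteq> 0"
    using that by (simp add: num_form_def field_simps power2_eq_square)
  show "den_form m x y = y ^ (m + 2) * poly (den_form m zvar 1) (x / y)" if "y \<noteq> 0"
    using that by (simp add: den_form_def field_simps power2_eq_square)
  show "num_form m x 0 = coeff (num_form m zvar 1) (m + 2) * x ^ (m + 2)"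
    unfolding num_form_zvar by (simp add: num_form_def power_add power2_eq_square)
  show "den_form m x 0 = coeff (den_form m zvar 1) (m + 2) * x ^ (m + 2)" if "m > 0"
    using that unfolding den_form_zvar by (simp add: den_form_def coeff_pCons split: nat.splits)
qed

lemma phi_point:
  assumes "m > 0" "x \<noteq> 0 \<or> y \<noteq> 0"
  shows "phi_fixing m (point x y) = point (\<i> * num_form m x y) (den_form m x y)"
    and "phi_swapping m (point x y) = point (den_form m x y) (\<i> * num_form m x y)"
proof -
  have "max (degree (smult \<i> (num_form m zvar 1))) (degree (den_form m zvar 1)) = m + 2"
    by (simp add: degree_num_form degree_den_form)
  then show "phi_fixing m (point x y) = point (\<i> * num_form m x y) (den_form m x y)"
    unfolding phi_fixing_def
    by (rule quotient_map_point[where F = "\<lambda>x y. \<i> * num_form m x y"])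
       (use assms homogeneous_forms in \<open>simp_all add: mult_ac del: poly_num_form poly_den_form power_Suc power_add\<close>)
  have "max (degree (den_form m zvar 1)) (degree (smult \<i> (num_form m zvar 1))) = m + 2"
    by (simp add: degree_num_form degree_den_form)
  then show "phi_swapping m (point x y) = point (den_form m x y) (\<i> * num_form m x y)"
    unfolding phi_swapping_def
    by (rule quotient_map_point[where G = "\<lambda>x y. \<i> * num_form m x y"])
       (use assms homogeneous_forms in \<open>simp_all add: mult_ac del: poly_num_form poly_den_form power_Suc power_add\<close>)
qed

lemma degree_phi:
  assumes "m > 0"
  shows "rational_map_of_degree (m + 2) (phi_fixing m)" "rational_map_of_degree (m + 2) (phi_swapping m)"
proof -
  have 1: "coprime (smult \<i> (num_form m zvar 1)) (den_form m zvar 1)"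
    using coprime_forms[OF assms] by (rule coprime_divisors[rotated -1]) (auto intro: smult_dvd)
  have 2: "coprime (den_form m zvar 1) (smult \<i> (num_form m zvar 1))"
    using 1 by (simp add: coprime_commute)
  show "rational_map_of_degree (m + 2) (phi_fixing m)"
    unfolding rational_map_of_degree_def phi_fixing_def
    by (intro exI conjI, rule 1) (auto simp: degree_num_form degree_den_form)
  show "rational_map_of_degree (m + 2) (phi_swapping m)"
    unfolding rational_map_of_degree_def phi_swapping_def
    by (intro exI conjI, rule 2) (auto simp: degree_num_form degree_den_form)
qed

text \<open>
  Evaluating the commutation at \<open>cnj z\<close> makes both sides holomorphic in \<open>z\<close>, and cross-multiplying
  the homogeneous coordinates gives the polynomial equation treated above. The conjugation turns
  the coefficient \<open>\<i>\<close> of \<open>\<psi>\<close> into \<open>- \<i>\<close> on one side only.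
\<close>
lemma no_commuting_involution:
  assumes m: "odd m" and \<phi>: "m \<ge> 3 \<and> \<phi> = phi_fixing m \<or> \<phi> = phi_swapping m"
    and Q: "antiholomorphic_mobius Q" "Q \<circ> Q = id"
  shows "Q \<circ> \<phi> \<noteq> \<phi> \<circ> Q"
proof
  assume comm: "Q \<circ> \<phi> = \<phi> \<circ> Q"
  obtain a b c d where det: "a * d - b * c = 1" and Qdef: "Q = mobius a b c d \<circ> conj_map"
    using Q(1) by (auto simp: antiholomorphic_mobius_def PSL2C_def)
  have m0: "m > 0" using m by (rule odd_pos)
  have det0: "a * d - b * c \<noteq> 0" using det by simp
  have Qp: "Q (point x y) = point (a * cnj x + b * cnj y) (c * cnj x + d * cnj y)" if "x \<noteq> 0 \<or> y \<noteq> 0" for x y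
    unfolding Qdef using that by (simp add: conj_map_point mobius_point)
  have comm': "Q (\<phi> (point (cnj z) 1)) = \<phi> (Q (point (cnj z) 1))" for z
    using fun_cong[OF comm] by simp
  obtain A B A' B' where
    coeffs: "m \<ge> 3 \<and> A = - \<i> * a \<and> B = b \<and> A' = c \<and> B' = \<i> * d \<or>
                 A = - \<i> * d \<and> B = c \<and> A' = b \<and> B' = \<i> * a"
    and cross: "\<And>z. num_form m (a * z + b) (c * z + d) * (A' * num_form m z 1 + B' * den_form m z 1) =
                     den_form m (a * z + b) (c * z + d) * (A * num_form m z 1 + B * den_form m z 1)"
  proof -
    have nz: "a * z + b \<noteq> 0 \<or> c * z + d \<noteq> 0" for z
      using linear_nonzero[OF det0, of z 1] by simp
    note nz' = forms_nonzero[OF m0 nz]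
    have nz1: "num_form m z 1 \<noteq> 0 \<or> den_form m z 1 \<noteq> 0" for z :: complex
      using forms_nonzero[OF m0, of z 1] by simp
    from \<phi> show thesis
    proof
      assume h: "m \<ge> 3 \<and> \<phi> = phi_fixing m"
      show thesis
      proof (rule that[of "- \<i> * a" b c "\<i> * d"])
        fix z
        have "point (a * (- \<i> * num_form m z 1) + b * den_form m z 1) (c * (- \<i> * num_form m z 1) + d * den_form m z 1) =
          point (\<i> * num_form m (a * z + b) (c * z + d)) (den_form m (a * z + b) (c * z + d))"
          using comm'[of z] h nz[of z] nz1[of "cnj z"] by (simp add: phi_point[OF m0] Qp)
        then have "(a * (- \<i> * num_form m z 1) + b * den_form m z 1) * den_form m (a * z + b) (c * z + d) =
           \<i> * num_form m (a * z + b) (c * z + d) * (c * (- \<i> * num_form m z 1) + d * den_form m z 1)"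
          by (subst (asm) point_eq_iff) (use nz' nz1 linear_nonzero[OF det0, of "- \<i> * num_form m z 1" "den_form m z 1"] in auto)
        then show "num_form m (a * z + b) (c * z + d) * (c * num_form m z 1 + \<i> * d * den_form m z 1) =
                     den_form m (a * z + b) (c * z + d) * (- \<i> * a * num_form m z 1 + b * den_form m z 1)"
          using i_squared by algebra
      qed (use h in auto)
    next
      assume h: "\<phi> = phi_swapping m"
      show thesis
      proof (rule that[of "- \<i> * d" c b "\<i> * a"])
        fix z
        have "point (a * den_form m z 1 + b * (- \<i> * num_form m z 1)) (c * den_form m z 1 + d * (- \<i> * num_form m z 1)) =
          point (den_form m (a * z + b) (c * z + d)) (\<i> * num_form m (a * z + b) (c * z + d))"
          using comm'[of z] h nz[of z] nz1[of "cnj z"] by (auto simp: phi_point[OF m0] Qp)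
        then have "(a * den_form m z 1 + b * (- \<i> * num_form m z 1)) * (\<i> * num_form m (a * z + b) (c * z + d)) =
           den_form m (a * z + b) (c * z + d) * (c * den_form m z 1 + d * (- \<i> * num_form m z 1))"
          by (subst (asm) point_eq_iff) (use nz' nz1 linear_nonzero[OF det0, of "den_form m z 1" "- \<i> * num_form m z 1"] in auto)
        then show "num_form m (a * z + b) (c * z + d) * (b * num_form m z 1 + \<i> * a * den_form m z 1) =
                     den_form m (a * z + b) (c * z + d) * (- \<i> * d * num_form m z 1 + c * den_form m z 1)"
          using i_squared by algebra
      qed auto
    qed
  qed
  from diagonal_or_antidiagonal[OF m det0 coeffs cross] show False
  proof
    assume h: "b = 0 \<and> c = 0"
    show False
      by (rule not_diagonal[OF m, of a d A B']) (use h det coeffs cross in auto)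
  next
    assume h: "a = 0 \<and> d = 0"
    then have bc: "b \<noteq> 0" "c \<noteq> 0" using det by auto
    have AB: "A = 0 \<and> B' = 0 \<and> B \<noteq> 0" using coeffs h bc by auto
    (* A zero of the map goes to a pole under z |-> b / (c z), which determines (b / c)^2. *)
    have "num_form m (1::complex) 1 = 0" by (simp add: num_form_def)
    then have "den_form m b c = 0" using cross[of 1] AB h by (simp add: den_form_def)
    then have sq: "b\<^sup>2 + c\<^sup>2 = 0" using bc by (simp add: den_form_def)
    (* An involution of this shape has b / c real. *)
    have "Q (Q (point 1 1)) = point 1 1" using fun_cong[OF Q(2)] by simp
    then have "point (b * cnj c) (c * cnj b) = point 1 1" using bc h by (simp add: Qp)
    then have sym: "b * cnj c = c * cnj b" using bc by (simp add: point_eq_iff)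
    have "(b / c)\<^sup>2 = -1" using sq bc by (simp add: field_simps add_eq_0_iff)
    moreover have "cnj (b / c) = b / c" using sym bc by (simp add: field_simps)
    then obtain r where "b / c = of_real r" by (metis Reals_cnj_iff Reals_cases)
    ultimately have "complex_of_real (r\<^sup>2) = of_real (-1)" by simp
    then have "r\<^sup>2 = -1" by (simp only: of_real_eq_iff)
    then show False by (smt (verit) zero_le_power2)
  qed
qed

section \<open>The automorphism of order 4\<close>

definition sqrt_i :: complex where
  "sqrt_i = csqrt \<i>"

lemma sqrt_i: "sqrt_i\<^sup>2 = \<i>" "sqrt_i \<noteq> 0"
proof -
  show *: "sqrt_i\<^sup>2 = \<i>" unfolding sqrt_i_def by (rule power2_csqrt)
  then show "sqrt_i \<noteq> 0" by auto
qed

text \<open>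
  The map \<open>z \<mapsto> \<i> / cnj z\<close>; the factor \<open>sqrt_i\<close> normalizes the determinant to 1.
\<close>
definition Q4 :: "riemann_sphere \<Rightarrow> riemann_sphere" where
  "Q4 = mobius 0 (\<i> * sqrt_i) sqrt_i 0 \<circ> conj_map"

lemma Q4_point:
  assumes "x \<noteq> 0 \<or> y \<noteq> 0"
  shows "Q4 (point x y) = point (\<i> * cnj y) (cnj x)"
proof -
  have "Q4 (point x y) = point (\<i> * sqrt_i * cnj y) (sqrt_i * cnj x)"
    using assms by (simp add: Q4_def conj_map_point mobius_point)
  also have "\<dots> = point (\<i> * cnj y) (cnj x)"
    using assms sqrt_i by (subst point_eq_iff) auto
  finally show ?thesis .
qed

lemma antiholomorphic_Q4: "antiholomorphic_mobius Q4"
proof -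
  have "0 * 0 - \<i> * sqrt_i * sqrt_i = - \<i> * sqrt_i\<^sup>2"
    by (simp add: power2_eq_square)
  also have "\<dots> = 1" using sqrt_i by simp
  finally show ?thesis unfolding antiholomorphic_mobius_def PSL2C_def Q4_def by blast
qed

lemma Q4_pow4: "Q4 ^^ 4 = id"
proof
  fix w :: riemann_sphere
  obtain x y where "w = point x y" "x \<noteq> 0 \<or> y \<noteq> 0" by (rule sphere_cases)
  then show "(Q4 ^^ 4) w = id w" by (auto simp: numeral_eq_Suc Q4_point point_eq_iff)
qed

lemma has_order_Q4: "has_order Q4 4"
proof -
  have "(Q4 ^^ k) (point 1 1) \<noteq> point 1 1" if "0 < k" "k < 4" for k
  proof -
    have "k = 1 \<or> k = 2 \<or> k = 3" using that by auto
    then show ?thesis by (auto simp: numeral_eq_Suc Q4_point point_eq_iff complex_eq_iff)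
  qed
  then show ?thesis using Q4_pow4 unfolding has_order_def by (metis id_apply zero_less_numeral)
qed

lemma bij_Q4: "bij Q4"
proof (rule o_bij[of "Q4 ^^ 3"])
  show "Q4 ^^ 3 \<circ> Q4 = id" using Q4_pow4 by (simp add: numeral_eq_Suc o_assoc)
  show "Q4 \<circ> Q4 ^^ 3 = id" using Q4_pow4 by (simp add: numeral_eq_Suc o_assoc)
qed

text \<open>
  Substituting \<open>(\<i> y, x)\<close> for \<open>(x, y)\<close> exchanges the two forms, with a factor \<open>- \<i> ^ m\<close> on one of them. The residue of
  \<open>m\<close> modulo 4 decides whether this factor, together with the coefficient \<open>\<i>\<close> and its conjugate,
  cancels for \<open>\<psi>\<close> or for \<open>1 / \<psi>\<close>.
\<close>
lemma commuting_Q4: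
  shows "m mod 4 = 3 \<Longrightarrow> Q4 \<circ> phi_fixing m = phi_fixing m \<circ> Q4"
    and "m mod 4 = 1 \<Longrightarrow> Q4 \<circ> phi_swapping m = phi_swapping m \<circ> Q4"
proof -
  have e: "num_form m (\<i> * y) x = - (\<i> ^ m) * den_form m x y" "den_form m (\<i> * y) x = num_form m x y" for x y
    by (simp_all add: num_form_def den_form_def power_mult_distrib algebra_simps)
  have i4: "\<i> ^ m = \<i> ^ (m mod 4)"
  proof -
    have four: "\<i> ^ 4 = 1" by (simp add: power4_eq_xxxx)
    have "\<i> ^ m = \<i> ^ (4 * (m div 4) + m mod 4)" by simp
    also have "\<dots> = \<i> ^ (m mod 4)" by (simp only: power_add power_mult four power_one mult_1)
    finally show ?thesis .
  qed
  show "Q4 \<circ> phi_fixing m = phi_fixing m \<circ> Q4" if "m mod 4 = 3"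
  proof
    fix w
    obtain x y where w: "w = point x y" "x \<noteq> 0 \<or> y \<noteq> 0" by (rule sphere_cases)
    have m0: "m > 0" using that by (cases m) auto
    have n: "num_form m x y \<noteq> 0 \<or> den_form m x y \<noteq> 0" "num_form m (cnj x) (cnj y) \<noteq> 0 \<or> den_form m (cnj x) (cnj y) \<noteq> 0"
      using forms_nonzero[OF m0] w by auto
    have im: "\<i> ^ m = - \<i>" using i4 unfolding that by (simp add: power3_eq_cube)
    show "(Q4 \<circ> phi_fixing m) w = (phi_fixing m \<circ> Q4) w"
      using w n by (auto simp: Q4_point phi_point[OF m0] e im point_eq_iff)
  qed
  show "Q4 \<circ> phi_swapping m = phi_swapping m \<circ> Q4" if "m mod 4 = 1"
  proof
    fix w
    obtain x y where w: "w = point x y" "x \<noteq> 0 \<or> y \<noteq> 0" by (rule sphere_cases)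
    have m0: "m > 0" using that by (cases m) auto
    have n: "num_form m x y \<noteq> 0 \<or> den_form m x y \<noteq> 0" "num_form m (cnj x) (cnj y) \<noteq> 0 \<or> den_form m (cnj x) (cnj y) \<noteq> 0"
      using forms_nonzero[OF m0] w by auto
    have im: "\<i> ^ m = \<i>" using i4 unfolding that by simp
    show "(Q4 \<circ> phi_swapping m) w = (phi_swapping m \<circ> Q4) w"
      using w n by (auto simp: Q4_point phi_point[OF m0] e im point_eq_iff)
  qed
qed

section \<open>Pseudo-real maps of every odd degree\<close>

theorem corollary5:
  fixes d :: nat
  assumes "d \<ge> 3" and "odd d"
  shows "\<exists>\<phi>. rational_map_of_degree d \<phi> \<and> pseudo_real \<phi> \<and>
           (\<exists>Q. antiholomorphic_automorphism \<phi> Q \<and> has_order Q 4)"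
proof -
  define m where "m = d - 2"
  have d: "d = m + 2" and m: "odd m" "m > 0" using assms by (auto simp: m_def)
  obtain \<phi> where deg: "rational_map_of_degree d \<phi>" and comm: "Q4 \<circ> \<phi> = \<phi> \<circ> Q4"
    and \<phi>: "m \<ge> 3 \<and> \<phi> = phi_fixing m \<or> \<phi> = phi_swapping m"
  proof (cases "m mod 4 = 3")
    case True
    then have "m \<ge> 3" by presburger
    then show ?thesis using that[of "phi_fixing m"] True degree_phi(1)[OF m(2)] commuting_Q4(1) d by simp
  next
    case False
    then have "m mod 4 = 1" using m by presburger
    then show ?thesis using that[of "phi_swapping m"] degree_phi(2)[OF m(2)] commuting_Q4(2) d by simp
  qed
  have "Q4 \<circ> \<phi> \<circ> inv Q4 = \<phi> \<circ> (Q4 \<circ> inv Q4)" unfolding comm by (simp add: o_assoc)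
  also have "\<dots> = \<phi>" using bij_is_surj[OF bij_Q4] by (simp add: surj_iff)
  finally have aut: "antiholomorphic_automorphism \<phi> Q4"
    using antiholomorphic_Q4 by (simp add: antiholomorphic_automorphism_def)
  have "\<not> is_reflection Q" if Q: "antiholomorphic_automorphism \<phi> Q" for Q
  proof
    assume "is_reflection Q"
    then have inv: "Q \<circ> Q = id" and anti: "antiholomorphic_mobius Q" by (auto simp: is_reflection_def)
    have "inv Q = Q" using inv inv by (rule inv_unique_comp)
    then have "Q \<circ> \<phi> \<circ> Q = \<phi>" using Q by (simp add: antiholomorphic_automorphism_def)
    then have "Q \<circ> \<phi> \<circ> (Q \<circ> Q) = \<phi> \<circ> Q" by (metis o_assoc)
    then have "Q \<circ> \<phi> = \<phi> \<circ> Q" unfolding inv by simp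
    then show False using no_commuting_involution[OF m(1) \<phi> anti inv] by simp
  qed
  then have "pseudo_real \<phi>" using aut unfolding pseudo_real_def by blast
  then show ?thesis using deg aut has_order_Q4 by blast
qed

end
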